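(* Let $k,l,n\in\mathbb{N}$. Then \[ \begin{split} n\, u_{k,l}(n) &= (2k+l)\sigma(n) - 2(5k +2l) \sigma(n/2) + 8k \sigma(n/4) \\ &\quad+ \sum_{j=1}^{n-1} u_{k,l}(j)\left( (2k+l)\sigma(n-j) -2(5k+2l)\sigma\!\left(\tfrac{n-j}{2}\right) + 8k\,\sigma\!\left(\tfrac{n-j}{4}\right) \right). \end{split} \]
   Context: For $k,l\in\mathbb{N}$ and $n\in\mathbb{N}_0$, $u_{k,l}(n)=\#\{(x_1,\dots,x_k,y_1,\dots,y_l)\in\mathbb{Z}^k\times\mathbb{N}_0^l : n=\sum_{i=1}^k x_i^2+\sum_{i=1}^l \frac{y_i(y_i+1)}{2}\}$, where $\mathbb{N}_0=\{0,1,2,\dots\}$. The function $\sigma$ is defined on $\mathbb{Q}$ by $\sigma(0)=1$, $\sigma(q)=0$ if $q\in\mathbb{Q}\setminus\mathbb{N}_0$, and $\sigma(q)=\sum_{d\mid q} d$ for $q\in\mathbb{N}=\{1,2,\dots\}$. *)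

theory Defs
  imports Complex_Main
begin

text \<open>The tuples in \<open>\<int>\<^sup>k \<times> \<nat>\<^sub>0\<^sup>l\<close> are encoded as lists of lengths \<open>k\<close> and \<open>l\<close>. The division by 2
  is exact, as \<open>y * (y + 1)\<close> is even. The set is finite for every \<open>k\<close>, \<open>l\<close> and \<open>n\<close>, so its
  \<open>card\<close> is the true count.\<close>

definition u :: "nat \<Rightarrow> nat \<Rightarrow> nat \<Rightarrow> nat" where
  "u k l n = card {(xs :: int list, ys :: nat list).
     length xs = k \<and> length ys = l \<and>
     int n = (\<Sum>x\<leftarrow>xs. x\<^sup>2) + (\<Sum>y\<leftarrow>ys. int (y * (y + 1) div 2))}"

text \<open>The conventional value at 0 is 1. For \<open>q \<in> \<nat>\<close>, \<open>nat \<lfloor>q\<rfloor>\<close> is \<open>q\<close> itself, as a natural number.\<close>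

definition sigma :: "rat \<Rightarrow> nat" where
  "sigma q = (if q = 0 then 1
              else if q \<in> \<nat> then \<Sum>{d. d dvd nat \<lfloor>q\<rfloor>}
              else 0)"

end

theory Submission
  imports Defs "HOL-Computational_Algebra.Formal_Power_Series"
begin

text \<open>The generating function of \<open>u k l\<close> is \<open>\<phi>^k * \<psi>^l\<close>, where \<open>\<phi>\<close> and \<open>\<psi>\<close> count squares and
  triangular numbers. Shanks' finite versions of Gauss' product formulas show that, up to any
  given order, with \<open>e a\<close> the product of the \<open>1 - X^(a * i)\<close>,
  \<open>\<phi> = (e 2)^5 / ((e 1)^2 * (e 4)^2)\<close> and \<open>\<psi> = (e 2)^2 / e 1\<close>. The logarithmic derivative
  \<open>X * f' / f\<close> of \<open>e a\<close> has the coefficients \<open>- a * \<sigma>(n / a)\<close>, and the claim is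
  a comparison of coefficients in \<open>X * U' = D * U\<close> for \<open>U = \<phi>^k * \<psi>^l\<close>.\<close>

section \<open>Shanks' finite identities\<close>

text \<open>On the left, the summands with \<open>s \<ge> 1\<close> have order greater than \<open>n\<close> in \<open>x\<close>, so to that order
  only the product at \<open>s = 0\<close> remains. In the induction step the change of the summands with \<open>s \<le> n\<close>
  is, up to the factor \<open>y\<close>, the telescoping difference \<open>b (s + 1) - b s\<close>.\<close>

lemma shanks_triangular:
  fixes x :: "'a::idom" and g :: "nat \<Rightarrow> 'a"
  assumes g: "\<And>k. (1 - x ^ (2*k+1)) * g (Suc k) = 1 - x ^ (2*k+2)"
    and nz: "\<And>k. 1 - x ^ (2*k+1) \<noteq> 0"
  shows "(\<Sum>s\<le>n. x ^ (s*(2*n+1)) * (\<Prod>k\<in>{s<..n}. g k)) = (\<Sum>t\<le>2*n. x ^ (t*(t+1) div 2))"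
proof (induction n)
  case 0
  show ?case by simp
next
  case (Suc n)
  define a where "a s = x ^ (s*(2*n+1)) * (\<Prod>k\<in>{s<..n}. g k)" for s
  \<comment> \<open>For \<open>s \<ge> 1\<close> the added factor is the numerator of
    \<open>g s\<close>, so that \<open>b (Suc s)\<close> arises from \<open>a s\<close> without
    division. It vanishes at \<open>s = 0\<close>, so telescoping leaves no lower boundary
    term.\<close>
  define b where "b s = a s * (1 - x ^ (2*s))" for s
  \<comment> \<open>This is the denominator of \<open>g (Suc n)\<close>, the factor that each old
    product gains in the induction step.\<close>
  define y where "y = 1 - x ^ (2*n+1)"
  have b_Suc: "b (Suc s) = x ^ (2*n+1) * (1 - x ^ (2*s+1)) * a s" if "s < n" for s
  proof -
    have "{s<..n} = insert (Suc s) {Suc s<..n}" using that by auto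
    then have "(\<Prod>k\<in>{s<..n}. g k) = g (Suc s) * (\<Prod>k\<in>{Suc s<..n}. g k)" by simp
    then have "x ^ (2*n+1) * (1 - x ^ (2*s+1)) * a s =
      x ^ (2*n+1) * x ^ (s*(2*n+1)) * (\<Prod>k\<in>{Suc s<..n}. g k) * ((1 - x ^ (2*s+1)) * g (Suc s))"
      unfolding a_def by (simp add: mult_ac)
    also have "x ^ (2*n+1) * x ^ (s*(2*n+1)) = x ^ (Suc s*(2*n+1))"
      by (simp only: mult_Suc power_add)
    finally have "x ^ (2*n+1) * (1 - x ^ (2*s+1)) * a s =
      x ^ (Suc s*(2*n+1)) * (\<Prod>k\<in>{Suc s<..n}. g k) * (1 - x ^ (2*s+2))"
      unfolding g .
    moreover have "2 * Suc s = 2*s+2" by simp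
    ultimately show ?thesis unfolding b_def a_def by (simp only:)
  qed
  have step: "a s * (x ^ (2*s) * (1 - x ^ (2*n+2)) - y) =
      x ^ (2*n+1) * (1 - x ^ (2*s+1)) * a s - b s" for s
    unfolding y_def b_def by (simp add: algebra_simps power_add power2_eq_square)
  have tele: "(\<Sum>s<m. a s * (x ^ (2*s) * (1 - x ^ (2*n+2)) - y)) = b m" if "m \<le> n" for m
    using that
  proof (induction m)
    case 0
    show ?case by (simp add: b_def)
  next
    case (Suc m)
    then show ?case using step[of m] b_Suc[of m] by simp
  qed
  have "(\<Sum>s\<le>n. a s * (x ^ (2*s) * (1 - x ^ (2*n+2)) - y)) =
      b n + a n * (x ^ (2*n) * (1 - x ^ (2*n+2)) - y)"
    using tele[of n] by (simp add: lessThan_Suc_atMost[symmetric])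
  \<comment> \<open>At \<open>s = n\<close> there is no \<open>b (Suc n)\<close> to telescope into.
    The \<open>- b n\<close> from \<open>step\<close> cancels the telescoped \<open>b n\<close>, and
    the rest is the remainder.\<close>
  also have "\<dots> = x ^ (2*n+1) * y * x ^ (n*(2*n+1))"
    unfolding step by (simp add: a_def y_def)
  also have "\<dots> = y * x ^ (Suc n*(2*n+1))"
  proof -
    have "x ^ (Suc n*(2*n+1)) = x ^ (2*n+1) * x ^ (n*(2*n+1))"
      by (simp only: mult_Suc power_add)
    then show ?thesis by (simp only: mult_ac)
  qed
  finally have tot: "(\<Sum>s\<le>n. a s * (x ^ (2*s) * (1 - x ^ (2*n+2)) - y)) =
    y * x ^ (Suc n*(2*n+1))" .
  have "y * (\<Sum>s\<le>n. x ^ (s*(2*Suc n+1)) * (\<Prod>k\<in>{s<..Suc n}. g k)) =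
      (\<Sum>s\<le>n. a s * x ^ (2*s) * (1 - x ^ (2*n+2)))"
    unfolding sum_distrib_left
  proof (rule sum.cong)
    fix s assume "s \<in> {..n}"
    then have "{s<..Suc n} = insert (Suc n) {s<..n}" by auto
    then have p: "(\<Prod>k\<in>{s<..Suc n}. g k) = g (Suc n) * (\<Prod>k\<in>{s<..n}. g k)" by simp
    have e: "x ^ (s*(2*Suc n+1)) = x ^ (s*(2*n+1)) * x ^ (2*s)"
      by (simp flip: power_add add: algebra_simps)
    show "y * (x ^ (s*(2*Suc n+1)) * (\<Prod>k\<in>{s<..Suc n}. g k)) =
      a s * x ^ (2*s) * (1 - x ^ (2*n+2))"
      unfolding p e a_def y_def g[of n, symmetric] by (simp add: mult_ac)
  qed simp
  also have "\<dots> = (\<Sum>s\<le>n. y * a s) + (\<Sum>s\<le>n. a s * (x ^ (2*s) * (1 - x ^ (2*n+2)) - y))"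
    unfolding sum.distrib[symmetric] by (rule sum.cong) (simp_all add: right_diff_distrib mult_ac)
  also have "\<dots> = y * (\<Sum>s\<le>n. a s) + y * x ^ (Suc n*(2*n+1))"
    unfolding tot by (simp only: sum_distrib_left)
  finally have "(\<Sum>s\<le>n. x ^ (s*(2*Suc n+1)) * (\<Prod>k\<in>{s<..Suc n}. g k)) =
      (\<Sum>s\<le>n. a s) + x ^ (Suc n*(2*n+1))"
    using nz[of n] unfolding y_def distrib_left[symmetric] by (simp only: mult_cancel_left) simp
  moreover have "(\<Sum>s\<le>n. a s) = (\<Sum>t\<le>2*n. x ^ (t*(t+1) div 2))"
    using Suc unfolding a_def .
  \<comment> \<open>Of the two new monomials, \<open>t = 2*n+1\<close> is the remainder of the
    telescoping and \<open>t = 2*n+2\<close> is the new summand \<open>s = Suc n\<close> on the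
    left.\<close>
  moreover have "(\<Sum>t\<le>2*Suc n. x ^ (t*(t+1) div 2)) = (\<Sum>t\<le>2*n. x ^ (t*(t+1) div 2))
      + x ^ (Suc n*(2*n+1)) + x ^ (Suc n*(2*Suc n+1))"
  proof -
    have "(2*n+1)*(2*n+1+1) div 2 = Suc n*(2*n+1)" "(2*n+2)*(2*n+2+1) div 2 = Suc n*(2*Suc n+1)"
      by (simp_all add: algebra_simps)
    moreover have "sum f {..2*Suc n} = sum f {..2*n} + f (2*n+1) + f (2*n+2)" for f :: "nat \<Rightarrow> 'a"
      by simp
    ultimately show ?thesis by (simp only:)
  qed
  ultimately show ?case
    by (simp only: sum.atMost_Suc[of _ n] greaterThanAtMost_empty[OF order_refl] prod.empty mult_1_right)
qed

text \<open>The telescoping is as before, for \<open>g k = (1 - x^k) / (1 + x^k)\<close>. The weight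
  \<open>e s = 2 / (1 + x^s)\<close> is 1 at \<open>s = 0\<close> and is the source of the factor 2
  on the right.\<close>

lemma shanks_square:
  fixes x :: "'a::idom" and g e :: "nat \<Rightarrow> 'a"
  assumes g: "\<And>k. (1 + x ^ k) * g k = 1 - x ^ k"
    and e: "\<And>k. (1 + x ^ k) * e k = 2"
    and nz: "\<And>k. 1 + x ^ k \<noteq> 0"
  shows "(\<Sum>s\<le>n. (-1) ^ s * x ^ (s*(n+1)) * ((\<Prod>k\<in>{s<..n}. g k) * e s)) =
    1 + 2 * (\<Sum>s=1..n. (-1) ^ s * x ^ (s\<^sup>2))"
proof (induction n)
  case 0
  \<comment> \<open>At \<open>k = 0\<close> the assumption \<open>nz\<close> says that the
    characteristic is not 2, so 2 can be cancelled.\<close>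
  have "2 * (e 0 - 1) = 0" using e[of 0] by (simp add: algebra_simps)
  moreover have "(2::'a) \<noteq> 0" using nz[of 0] by simp
  ultimately show ?case by simp
next
  case (Suc n)
  define a where "a s = (-1) ^ s * x ^ (s*(n+1)) * ((\<Prod>k\<in>{s<..n}. g k) * e s)" for s
  define b where "b s = a s * (1 - x ^ s)" for s
  define y where "y = 1 + x ^ (n+1)"
  \<comment> \<open>In the passage from \<open>s\<close> to \<open>Suc s\<close>, the factor
    \<open>1 + x ^ s\<close> collapses \<open>e s\<close> to 2, and this 2 together with
    \<open>g (Suc s)\<close> rebuilds \<open>e (Suc s)\<close>.\<close>
  have ge: "g k * 2 = e k * (1 - x ^ k)" for k
    using g[of k] e[of k] by (metis mult.commute mult.left_commute)
  have b_Suc: "b (Suc s) = - (x ^ (n+1) * (1 + x ^ s) * a s)" if "s < n" for s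
  proof -
    have "{s<..n} = insert (Suc s) {Suc s<..n}" using that by auto
    then have "(\<Prod>k\<in>{s<..n}. g k) = g (Suc s) * (\<Prod>k\<in>{Suc s<..n}. g k)" by simp
    then have "x ^ (n+1) * (1 + x ^ s) * a s =
      (-1) ^ s * (x ^ (n+1) * x ^ (s*(n+1))) * (\<Prod>k\<in>{Suc s<..n}. g k) * (g (Suc s) * ((1 + x ^ s) * e s))"
      unfolding a_def by (simp add: mult_ac)
    also have "x ^ (n+1) * x ^ (s*(n+1)) = x ^ (Suc s*(n+1))"
      by (simp only: mult_Suc power_add)
    finally have "x ^ (n+1) * (1 + x ^ s) * a s = (-1) ^ s * x ^ (Suc s*(n+1)) *
      (\<Prod>k\<in>{Suc s<..n}. g k) * (e (Suc s) * (1 - x ^ Suc s))"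
      unfolding e ge .
    then show ?thesis unfolding b_def a_def by (simp only: power_Suc mult_ac mult_minus1 mult_minus_left mult_minus_right mult_1_left)
  qed
  have step: "a s * (x ^ s * (1 - x ^ (n+1)) - y) =
      - (x ^ (n+1) * (1 + x ^ s) * a s) - b s" for s
    unfolding y_def b_def by (simp add: algebra_simps power_add)
  have tele: "(\<Sum>s<m. a s * (x ^ s * (1 - x ^ (n+1)) - y)) = b m" if "m \<le> n" for m
    using that
  proof (induction m)
    case 0
    show ?case by (simp add: b_def)
  next
    case (Suc m)
    then show ?case using step[of m] b_Suc[of m] by simp
  qed
  have "(\<Sum>s\<le>n. a s * (x ^ s * (1 - x ^ (n+1)) - y)) =
      b n + a n * (x ^ n * (1 - x ^ (n+1)) - y)"
    using tele[of n] by (simp add: lessThan_Suc_atMost[symmetric])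
  also have "\<dots> = - (x ^ (n+1) * ((-1) ^ n * x ^ (n*(n+1))) * ((1 + x ^ n) * e n))"
    unfolding step by (simp add: a_def mult_ac)
  finally have tot: "(\<Sum>s\<le>n. a s * (x ^ s * (1 - x ^ (n+1)) - y)) =
    2 * ((-1) ^ Suc n * x ^ ((Suc n)\<^sup>2))"
    unfolding e by (simp add: power_add mult_ac power2_eq_square)
  have "y * (\<Sum>s\<le>n. (-1) ^ s * x ^ (s*(Suc n+1)) * ((\<Prod>k\<in>{s<..Suc n}. g k) * e s)) =
      (\<Sum>s\<le>n. a s * x ^ s * (1 - x ^ (n+1)))"
    unfolding sum_distrib_left
  proof (rule sum.cong)
    fix s assume "s \<in> {..n}"
    then have "{s<..Suc n} = insert (Suc n) {s<..n}" by auto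
    then have p: "(\<Prod>k\<in>{s<..Suc n}. g k) = g (Suc n) * (\<Prod>k\<in>{s<..n}. g k)" by simp
    have q: "x ^ (s*(Suc n+1)) = x ^ (s*(n+1)) * x ^ s"
      by (simp flip: power_add add: algebra_simps)
    show "y * ((-1) ^ s * x ^ (s*(Suc n+1)) * ((\<Prod>k\<in>{s<..Suc n}. g k) * e s)) =
      a s * x ^ s * (1 - x ^ (n+1))"
      unfolding p q a_def y_def g[of "n+1", symmetric] by (simp add: mult_ac)
  qed simp
  also have "\<dots> = (\<Sum>s\<le>n. y * a s) + (\<Sum>s\<le>n. a s * (x ^ s * (1 - x ^ (n+1)) - y))"
    unfolding sum.distrib[symmetric] by (rule sum.cong) (simp_all add: right_diff_distrib mult_ac)
  also have "\<dots> = y * (\<Sum>s\<le>n. a s) + 2 * ((-1) ^ Suc n * x ^ ((Suc n)\<^sup>2))"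
    unfolding tot by (simp only: sum_distrib_left)
  finally have *: "y * (\<Sum>s\<le>n. (-1) ^ s * x ^ (s*(Suc n+1)) * ((\<Prod>k\<in>{s<..Suc n}. g k) * e s)) =
      y * (\<Sum>s\<le>n. a s) + 2 * ((-1) ^ Suc n * x ^ ((Suc n)\<^sup>2))" .
  \<comment> \<open>The new summand \<open>s = Suc n\<close> is \<open>x ^ (n+1)\<close> times the
    remainder of the telescoping. Together they contain \<open>1 + x ^ (n+1) = y\<close>, which can
    then be cancelled.\<close>
  have "y * (\<Sum>s\<le>Suc n. (-1) ^ s * x ^ (s*(Suc n+1)) * ((\<Prod>k\<in>{s<..Suc n}. g k) * e s)) =
      y * (\<Sum>s\<le>n. a s) + 2 * ((-1) ^ Suc n * x ^ ((Suc n)\<^sup>2))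
      + (-1) ^ Suc n * x ^ (Suc n*(Suc n+1)) * (y * e (Suc n))"
    unfolding sum.atMost_Suc distrib_left[of y] *
    by (simp only: greaterThanAtMost_empty[OF order_refl] prod.empty mult_1_left mult_ac)
  also have "y * e (Suc n) = 2" using e[of "Suc n"] by (simp add: y_def)
  also have "x ^ (Suc n*(Suc n+1)) = x ^ ((Suc n)\<^sup>2) * x ^ (n+1)"
    by (simp only: power_add[symmetric]) (simp add: power2_eq_square add_ac)
  finally have "y * (\<Sum>s\<le>Suc n. (-1) ^ s * x ^ (s*(Suc n+1)) * ((\<Prod>k\<in>{s<..Suc n}. g k) * e s)) =
      y * ((\<Sum>s\<le>n. a s) + 2 * ((-1) ^ Suc n * x ^ ((Suc n)\<^sup>2)))"
    unfolding y_def by (simp add: algebra_simps)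
  then have "(\<Sum>s\<le>Suc n. (-1) ^ s * x ^ (s*(Suc n+1)) * ((\<Prod>k\<in>{s<..Suc n}. g k) * e s)) =
      (\<Sum>s\<le>n. a s) + 2 * ((-1) ^ Suc n * x ^ ((Suc n)\<^sup>2))"
    using nz[of "n+1"] unfolding y_def by (simp only: mult_cancel_left) simp
  moreover have "(\<Sum>s\<le>n. a s) = 1 + 2 * (\<Sum>s=1..n. (-1) ^ s * x ^ (s\<^sup>2))"
    using Suc unfolding a_def .
  ultimately show ?case by (simp add: distrib_left)
qed

section \<open>Logarithmic derivatives of formal power series\<close>

text \<open>The equation \<open>D = X * f' / f\<close> is multiplied out, so that no quotient of
  power series has to be formed.\<close>

definition has_log_deriv :: "real fps \<Rightarrow> real fps \<Rightarrow> bool" where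
  "has_log_deriv f D \<longleftrightarrow> fps_X * fps_deriv f = D * f"

lemma has_log_deriv_1: "has_log_deriv 1 0"
  by (simp add: has_log_deriv_def)

lemma has_log_deriv_mult:
  assumes "has_log_deriv f D" "has_log_deriv g E"
  shows "has_log_deriv (f * g) (D + E)"
proof -
  have "fps_X * fps_deriv (f * g) = (fps_X * fps_deriv f) * g + f * (fps_X * fps_deriv g)"
    by (simp add: algebra_simps)
  with assms show ?thesis by (simp add: has_log_deriv_def algebra_simps)
qed

lemma has_log_deriv_power:
  "has_log_deriv f D \<Longrightarrow> has_log_deriv (f ^ n) (of_nat n * D)"
proof (induction n)
  case 0
  show ?case by (simp add: has_log_deriv_1)
next
  case (Suc n)
  then show ?case using has_log_deriv_mult[of f D "f ^ n" "of_nat n * D"]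
    by (simp add: algebra_simps)
qed

lemma has_log_deriv_prod:
  "(\<And>i. i \<in> A \<Longrightarrow> has_log_deriv (f i) (D i)) \<Longrightarrow> has_log_deriv (prod f A) (sum D A)"
  by (induction A rule: infinite_finite_induct)
    (auto intro: has_log_deriv_1 has_log_deriv_mult)

text \<open>This serves as the quotient rule: the products in Shanks' identities are known only
  through an equation with their denominators multiplied out.\<close>

lemma has_log_deriv_cancel:
  assumes "has_log_deriv (f * g) E" "has_log_deriv g D" "g \<noteq> 0"
  shows "has_log_deriv f (E - D)"
proof -
  have "(fps_X * fps_deriv f) * g + f * (fps_X * fps_deriv g) = E * f * g"
    using assms(1) by (simp add: has_log_deriv_def algebra_simps)
  moreover have "fps_X * fps_deriv g = D * g"
    using assms(2) by (simp add: has_log_deriv_def)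
  ultimately have "(fps_X * fps_deriv f) * g + f * (D * g) = E * f * g"
    by simp
  then have "(fps_X * fps_deriv f) * g = ((E - D) * f) * g"
    by (simp add: algebra_simps)
  with assms(3) show ?thesis by (simp add: has_log_deriv_def)
qed

text \<open>Coefficient \<open>N\<close> of either side of the defining equation depends only on
  coefficients up to \<open>N\<close> of \<open>f\<close> and \<open>D\<close>. Finite products can
  therefore replace infinite ones.\<close>

lemma has_log_deriv_limit:
  assumes "\<And>N. \<exists>f' D'. has_log_deriv f' D' \<and> (\<forall>i\<le>N. fps_nth f' i = fps_nth f i) \<and>
    (\<forall>i\<le>N. fps_nth D' i = fps_nth D i)"
  shows "has_log_deriv f D"
  unfolding has_log_deriv_def
proof (rule fps_ext)
  fix N
  obtain f' D' where *: "has_log_deriv f' D'" "\<And>i. i \<le> N \<Longrightarrow> fps_nth f' i = fps_nth f i"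
    "\<And>i. i \<le> N \<Longrightarrow> fps_nth D' i = fps_nth D i"
    using assms[of N] by blast
  have "fps_nth (fps_X * fps_deriv f) N = fps_nth (fps_X * fps_deriv f') N"
    using *(2)[of N] by (cases N) auto
  also have "\<dots> = fps_nth (D' * f') N" using *(1) by (simp add: has_log_deriv_def)
  also have "\<dots> = fps_nth (D * f) N"
    unfolding fps_mult_nth by (rule sum.cong) (auto simp: *(2,3))
  finally show "fps_nth (fps_X * fps_deriv f) N = fps_nth (D * f) N" .
qed

text \<open>This is the geometric series: \<open>- m * X^m / (1 - X^m)\<close> is the sum of
  \<open>- m * X^(m*j)\<close> over \<open>j \<ge> 1\<close>.\<close>

lemma has_log_deriv_one_minus_X_power:
  assumes "m > 0"
  shows "has_log_deriv (1 - fps_X ^ m) (- Abs_fps (\<lambda>i. if m dvd i \<and> i > 0 then real m else 0))"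
  unfolding has_log_deriv_def
proof (rule fps_ext)
  fix n
  let ?D = "Abs_fps (\<lambda>i. if m dvd i \<and> i > 0 then real m else 0)"
  have "fps_nth (fps_X * fps_deriv (1 - fps_X ^ m :: real fps)) n = (if n = m then - real m else 0)"
    using assms by (cases n) (auto simp: fps_X_power_iff)
  moreover have "fps_nth (- ?D * (1 - fps_X ^ m)) n = fps_nth (?D * fps_X ^ m) n - fps_nth ?D n"
    by (simp add: algebra_simps)
  \<comment> \<open>The series and its shift by \<open>m\<close> cancel except at
    \<open>n = m\<close>, where the shift reads the coefficient at 0, which the condition
    \<open>i > 0\<close> sets to 0.\<close>
  moreover have "fps_nth (?D * fps_X ^ m) n - fps_nth ?D n = (if n = m then - real m else 0)"
  proof (cases "n < m")
    case True
    then show ?thesis by (auto simp: fps_X_power_mult_right_nth dest: dvd_imp_le)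
  next
    case False
    then have "m dvd n - m \<longleftrightarrow> m dvd n" by (simp add: dvd_minus_self)
    with False assms show ?thesis by (auto simp: fps_X_power_mult_right_nth)
  qed
  ultimately show "fps_nth (fps_X * fps_deriv (1 - fps_X ^ m :: real fps)) n = fps_nth (- ?D * (1 - fps_X ^ m)) n"
    by simp
qed

section \<open>Euler products\<close>

lemma sigma_divide:
  assumes "a > 0" "n > 0"
  shows "sigma (of_nat n / of_nat a) = (if a dvd n then \<Sum>{d. d dvd n div a} else 0)"
proof (cases "a dvd n")
  case True
  then obtain m where "n = a * m" by blast
  with assms show ?thesis by (simp add: sigma_def)
next
  case False
  have "(of_nat n / of_nat a :: rat) \<notin> \<nat>"
  proof
    assume "(of_nat n / of_nat a :: rat) \<in> \<nat>"
    then obtain m where "(of_nat n / of_nat a :: rat) = of_nat m" by (auto elim: Nats_cases)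
    then have "(of_nat n :: rat) = of_nat (m * a)" using assms by (simp add: field_simps)
    then have "n = m * a" by (simp only: of_nat_eq_iff)
    with False show False by simp
  qed
  with False assms show ?thesis by (simp add: sigma_def)
qed

text \<open>Up to sign this is the logarithmic derivative of the infinite product of the
  \<open>1 - X^(a*k)\<close>. Its constant term is 0, unlike the conventional
  \<open>sigma 0 = 1\<close>, because \<open>fps_X * fps_deriv f\<close> has constant term
  0.\<close>

definition sigma_fps :: "nat \<Rightarrow> real fps" where
  "sigma_fps a = Abs_fps (\<lambda>i. if i = 0 then 0 else real a * real (sigma (of_nat i / of_nat a)))"

definition euler_prod :: "nat \<Rightarrow> nat \<Rightarrow> real fps" where
  "euler_prod a N = (\<Prod>k=1..N. 1 - fps_X ^ (a*k))"

lemma euler_prod_nonzero: "a > 0 \<Longrightarrow> euler_prod a N \<noteq> 0"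
proof -
  assume "a > 0"
  then have "fps_nth (1 - fps_X ^ (a*k) :: real fps) 0 \<noteq> 0" if "k \<in> {1..N}" for k
    using that by (simp add: fps_X_power_iff)
  then have "\<forall>k\<in>{1..N}. (1 - fps_X ^ (a*k) :: real fps) \<noteq> 0" by (metis fps_zero_nth)
  then show ?thesis by (simp add: euler_prod_def)
qed

text \<open>The factor with index \<open>k\<close> contributes \<open>- a*k\<close> at the multiples
  of \<open>a*k\<close>. At \<open>i\<close> these add up to \<open>- a\<close> times the sum of the
  divisors \<open>k\<close> of \<open>i / a\<close>.\<close>

lemma euler_prod_log_deriv:
  assumes "a > 0"
  obtains D where "has_log_deriv (euler_prod a N) D"
    "\<And>i. i \<le> N \<Longrightarrow> fps_nth D i = - fps_nth (sigma_fps a) i"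
proof
  let ?D = "\<lambda>k. - Abs_fps (\<lambda>i. if a*k dvd i \<and> i > 0 then real (a*k) else 0)"
  show "has_log_deriv (euler_prod a N) (\<Sum>k=1..N. ?D k)"
    unfolding euler_prod_def using assms
    by (intro has_log_deriv_prod has_log_deriv_one_minus_X_power) auto
  fix i assume "i \<le> N"
  show "fps_nth (\<Sum>k=1..N. ?D k) i = - fps_nth (sigma_fps a) i"
  proof (cases "i = 0")
    case True
    then show ?thesis by (simp add: sigma_fps_def fps_sum_nth)
  next
    case False
    then have "fps_nth (\<Sum>k=1..N. ?D k) i = - (\<Sum>k=1..N. if a*k dvd i then real (a*k) else 0)"
      by (simp add: fps_sum_nth sum_negf)
    also have "(\<Sum>k=1..N. if a*k dvd i then real (a*k) else 0) = (\<Sum>k\<in>{k\<in>{1..N}. a*k dvd i}. real (a*k))"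
      by (rule sum.inter_filter[symmetric]) simp
    also have "\<dots> = real a * real (sigma (of_nat i / of_nat a))"
    proof (cases "a dvd i")
      case True
      then obtain m where m: "i = a * m" by blast
      \<comment> \<open>The truncation at \<open>N\<close> loses no divisor, since a divisor of
        \<open>i div a\<close> is at most \<open>i \<le> N\<close>.\<close>
      have "{k\<in>{1..N}. a*k dvd i} = {d. d dvd i div a}"
      proof (intro equalityI subsetI)
        fix d assume "d \<in> {d. d dvd i div a}"
        then have d: "d dvd m" using m assms by simp
        have "m > 0" using m False by simp
        with d have "d \<le> m" "d > 0" by (auto intro: dvd_imp_le dvd_pos_nat)
        moreover have "m \<le> i" using m assms by simp
        ultimately have "d \<le> N" using \<open>i \<le> N\<close> by linarith
        with d \<open>d > 0\<close> show "d \<in> {k\<in>{1..N}. a*k dvd i}" by (simp add: m)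
      qed (use m assms in auto)
      then show ?thesis using True False assms by (simp add: sigma_divide flip: sum_distrib_left)
    next
      case na: False
      then have "{k\<in>{1..N}. a*k dvd i} = {}" by (auto dest: dvd_mult_left)
      then show ?thesis using na False assms by (simp only: sigma_divide) simp
    qed
    finally show ?thesis using False by (simp add: sigma_fps_def)
  qed
qed

lemma prod_split_parity:
  fixes f :: "nat \<Rightarrow> 'a::comm_monoid_mult"
  shows "(\<Prod>k=1..2*N. f k) = (\<Prod>k=1..N. f (2*k-1)) * (\<Prod>k=1..N. f (2*k))"
  by (induction N) (simp_all add: mult_ac)

lemma euler_prod_double:
  "euler_prod a (2*N) = (\<Prod>k=1..N. 1 - fps_X ^ (a*(2*k-1))) * euler_prod (2*a) N"
  unfolding euler_prod_def prod_split_parity by (simp add: mult_ac)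

section \<open>Generating functions of squares and triangular numbers\<close>

text \<open>This is the formal sum of \<open>X^(w x)\<close> over all \<open>x\<close>. It is meant
  for weights with finite fibres, as \<open>card\<close> is 0 on infinite sets.\<close>

definition count_fps :: "('a \<Rightarrow> nat) \<Rightarrow> real fps" where
  "count_fps w = Abs_fps (\<lambda>i. real (card {x. w x = i}))"

lemma abs_le_square_int: "\<bar>z\<bar> \<le> z\<^sup>2" for z :: int
  using self_le_power[of "\<bar>z\<bar>" 2] by (cases "z = 0") simp_all

lemma le_triangular: "t \<le> t*(t+1) div 2" for t :: nat
  by (cases t) auto

lemma fps_nth_sum_X_power:
  "finite S \<Longrightarrow> fps_nth (\<Sum>x\<in>S. fps_X ^ w x :: real fps) i = real (card {x\<in>S. w x = i})"
  by (simp add: fps_sum_nth fps_X_power_iff sum.If_cases Int_def eq_commute[of i])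

lemma fps_nth_X_power_mult_small:
  fixes h :: "real fps"
  shows "i < m \<Longrightarrow> fps_nth (fps_X ^ m * h) i = 0"
  by (simp add: fps_X_power_mult_nth)

lemma triangular_log_deriv:
  "has_log_deriv (count_fps (\<lambda>y::nat. y*(y+1) div 2)) (sigma_fps 1 - 2 * sigma_fps 2)"
proof (rule has_log_deriv_limit)
  fix N :: nat
  let ?X = "fps_X :: real fps"
  define g where "g k = (1 - ?X ^ (2*k)) * inverse (1 - ?X ^ (2*k-1))" for k
  have inv: "inverse (1 - ?X ^ (2*k+1)) * (1 - ?X ^ (2*k+1)) = 1" for k
    by (rule inverse_mult_eq_1) simp
  have g: "(1 - ?X ^ (2*k+1)) * g (Suc k) = 1 - ?X ^ (2*k+2)" for k
    using inv[of k] by (simp add: g_def mult_ac)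
  have nz: "1 - ?X ^ (2*k+1) \<noteq> 0" for k using inv[of k] by auto
  define P where "P = (\<Prod>k=1..N. g k)"
  have "P * (\<Prod>k=1..N. 1 - ?X ^ (1*(2*k-1))) = (\<Prod>k=1..N. 1 - ?X ^ (2*k))"
    unfolding P_def prod.distrib[symmetric]
  proof (rule prod.cong)
    fix k assume "k \<in> {1..N}"
    then show "g k * (1 - ?X ^ (1*(2*k-1))) = 1 - ?X ^ (2*k)"
      using g[of "k-1"] by (cases k) (auto simp: mult_ac)
  qed simp
  \<comment> \<open>\<open>P\<close> has the even factors above and the odd ones below. The even
    factors, multiplied in once more, complete the denominator to a full Euler product of length
    \<open>2*N\<close>.\<close>
  then have eq: "P * euler_prod 1 (2*N) = euler_prod 2 N * euler_prod 2 N"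
    unfolding euler_prod_double by (simp add: euler_prod_def flip: mult.assoc)
  obtain D1 where D1: "has_log_deriv (euler_prod 1 (2*N)) D1"
    "\<And>i. i \<le> 2*N \<Longrightarrow> fps_nth D1 i = - fps_nth (sigma_fps 1) i"
    using euler_prod_log_deriv[of 1 "2*N"] by auto
  obtain D2 where D2: "has_log_deriv (euler_prod 2 N) D2"
    "\<And>i. i \<le> N \<Longrightarrow> fps_nth D2 i = - fps_nth (sigma_fps 2) i"
    using euler_prod_log_deriv[of 2 N] by auto
  have "has_log_deriv P (D2 + D2 - D1)"
    by (rule has_log_deriv_cancel[OF _ D1(1)])
      (simp_all only: eq has_log_deriv_mult D2 euler_prod_nonzero zero_less_one not_False_eq_True)
  moreover have "fps_nth (D2 + D2 - D1) i = fps_nth (sigma_fps 1 - 2 * sigma_fps 2) i" if "i \<le> N" for i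
    using that by (simp add: D1 D2 fps_numeral_fps_const)
  moreover have "fps_nth P i = fps_nth (count_fps (\<lambda>y::nat. y*(y+1) div 2)) i" if "i \<le> N" for i
  proof -
    have *: "(\<Sum>s\<le>N. ?X ^ (s*(2*N+1)) * (\<Prod>k\<in>{s<..N}. g k)) = (\<Sum>t\<le>2*N. ?X ^ (t*(t+1) div 2))"
      by (rule shanks_triangular[OF g nz])
    have "fps_nth (\<Sum>t\<le>2*N. ?X ^ (t*(t+1) div 2)) i =
        (\<Sum>s\<le>N. fps_nth (?X ^ (s*(2*N+1)) * (\<Prod>k\<in>{s<..N}. g k)) i)"
      unfolding *[symmetric] by (rule fps_sum_nth)
    also have "\<dots> = (\<Sum>s\<in>{0}. fps_nth (?X ^ (s*(2*N+1)) * (\<Prod>k\<in>{s<..N}. g k)) i)"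
    proof (rule sum.mono_neutral_right)
      show "\<forall>s\<in>{..N} - {0}. fps_nth (?X ^ (s*(2*N+1)) * (\<Prod>k\<in>{s<..N}. g k)) i = 0"
      proof
        fix s assume "s \<in> {..N} - {0}"
        then have "1 * (2*N+1) \<le> s*(2*N+1)" by (intro mult_le_mono1) auto
        moreover have "i < 1 * (2*N+1)" using that by simp
        ultimately have "i < s*(2*N+1)" by (rule less_le_trans[rotated])
        then show "fps_nth (?X ^ (s*(2*N+1)) * (\<Prod>k\<in>{s<..N}. g k)) i = 0"
          by (rule fps_nth_X_power_mult_small)
      qed
    qed auto
    also have "\<dots> = fps_nth P i"
      by (simp add: P_def atLeastSucAtMost_greaterThanAtMost)
    finally have "fps_nth P i = real (card {t\<in>{..2*N}. t*(t+1) div 2 = i})"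
      by (simp only: fps_nth_sum_X_power finite_atMost)
    \<comment> \<open>Since \<open>i \<le> N\<close>, the bound \<open>2*N\<close> cuts off no
      \<open>t\<close> that represents \<open>i\<close>.\<close>
    moreover have "t \<in> {..2*N}" if "t*(t+1) div 2 = i" for t
      using le_triangular[of t] \<open>i \<le> N\<close> unfolding that by simp
    then have "{t\<in>{..2*N}. t*(t+1) div 2 = i} = {t. t*(t+1) div 2 = i}" by blast
    ultimately show ?thesis by (simp only: count_fps_def fps_nth_Abs_fps)
  qed
  ultimately show "\<exists>f' D'. has_log_deriv f' D' \<and>
      (\<forall>i\<le>N. fps_nth f' i = fps_nth (count_fps (\<lambda>y::nat. y*(y+1) div 2)) i) \<and>
      (\<forall>i\<le>N. fps_nth D' i = fps_nth (sigma_fps 1 - 2 * sigma_fps 2) i)"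
    by blast
qed

lemma square_log_deriv:
  "has_log_deriv (count_fps (\<lambda>x::int. nat (x\<^sup>2))) (2 * sigma_fps 1 - 5 * sigma_fps 2 + 2 * sigma_fps 4)"
proof (rule has_log_deriv_limit)
  fix N :: nat
  let ?X = "fps_X :: real fps"
  \<comment> \<open>Since \<open>s + s^2\<close> is even, this choice cancels the signs
    \<open>(-1) ^ s\<close> in \<open>shanks_square\<close>.\<close>
  define x where "x = - ?X"
  define g where "g k = (1 - x ^ k) * inverse (1 + x ^ k)" for k
  define e where "e k = 2 * inverse (1 + x ^ k)" for k
  have x: "x ^ k = (-1) ^ k * ?X ^ k" for k unfolding x_def by (rule power_minus)
  have "fps_nth (1 + x ^ k) 0 \<noteq> 0" for k
    by (cases k) (simp_all add: x_def)
  then have inv: "inverse (1 + x ^ k) * (1 + x ^ k) = 1" for k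
    by (rule inverse_mult_eq_1)
  have g: "(1 + x ^ k) * g k = 1 - x ^ k" and e: "(1 + x ^ k) * e k = 2" for k
    using inv[of k] by (simp_all add: g_def e_def mult_ac)
  have nz: "1 + x ^ k \<noteq> 0" for k using inv[of k] by auto
  define P where "P = (\<Prod>k=1..2*N. g k)"
  define A where "A = (\<Prod>k=1..N. 1 - ?X ^ (2*k-1))"
  define B where "B = (\<Prod>k=1..N. 1 + ?X ^ (2*k-1))"
  define C where "C = (\<Prod>k=1..N. 1 + ?X ^ (2*k))"
  \<comment> \<open>The sign of \<open>x\<close> interchanges numerator and denominator types at odd
    indices and leaves the even ones alone, so \<open>P\<close> is \<open>B * euler_prod 2 N\<close>
    over \<open>A * C\<close>.\<close>
  have odd: "(\<Prod>k=1..N. 1 + x ^ (2*k-1)) = A" "(\<Prod>k=1..N. 1 - x ^ (2*k-1)) = B"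
    unfolding A_def B_def by (rule prod.cong; auto simp: x)+
  have even: "(\<Prod>k=1..N. 1 + x ^ (2*k)) = C" "(\<Prod>k=1..N. 1 - x ^ (2*k)) = euler_prod 2 N"
    unfolding C_def euler_prod_def by (rule prod.cong; auto simp: x)+
  have "P * (\<Prod>k=1..2*N. 1 + x ^ k) = (\<Prod>k=1..2*N. 1 - x ^ k)"
    unfolding P_def prod.distrib[symmetric] by (rule prod.cong) (simp_all add: g mult.commute[of "g _"])
  then have PAC: "P * A * C = B * euler_prod 2 N"
    unfolding prod_split_parity odd even by (simp add: mult_ac)
  have Ae: "euler_prod 1 (2*N) = A * euler_prod 2 N"
    by (simp add: euler_prod_double A_def)
  have "B * A = (\<Prod>k=1..N. 1 - ?X ^ (2*(2*k-1)))"
    unfolding A_def B_def prod.distrib[symmetric]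
    by (rule prod.cong) (simp_all add: algebra_simps flip: power_add mult_2)
  then have BA: "euler_prod 2 (2*N) = B * A * euler_prod 4 N"
    by (simp add: euler_prod_double)
  have Ce: "euler_prod 4 N = C * euler_prod 2 N"
    unfolding C_def euler_prod_def prod.distrib[symmetric]
    by (rule prod.cong) (simp_all add: algebra_simps flip: power_add mult_2)
  \<comment> \<open>\<open>A\<close> and \<open>C\<close> are completed to Euler products by factors
    \<open>euler_prod 2 N\<close>. The fifth power of \<open>e 2\<close> shows up as four copies
    truncated at \<open>N\<close> and one at \<open>2*N\<close>, which does not matter for
    coefficients up to \<open>N\<close>.\<close>
  have "P * (euler_prod 1 (2*N) ^ 2 * euler_prod 4 N ^ 2) =
      (P * A * C) * A * C * euler_prod 2 N ^ 4"
    unfolding Ae Ce by (simp add: power2_eq_square power4_eq_xxxx mult_ac)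
  also have "\<dots> = euler_prod 2 N ^ 4 * euler_prod 2 (2*N)"
    unfolding PAC BA Ce by (simp add: mult_ac)
  finally have eq: "P * (euler_prod 1 (2*N) ^ 2 * euler_prod 4 N ^ 2) =
      euler_prod 2 N ^ 4 * euler_prod 2 (2*N)" .
  obtain D1 where D1: "has_log_deriv (euler_prod 1 (2*N)) D1"
    "\<And>i. i \<le> 2*N \<Longrightarrow> fps_nth D1 i = - fps_nth (sigma_fps 1) i"
    using euler_prod_log_deriv[of 1 "2*N"] by auto
  obtain D2 where D2: "has_log_deriv (euler_prod 2 N) D2"
    "\<And>i. i \<le> N \<Longrightarrow> fps_nth D2 i = - fps_nth (sigma_fps 2) i"
    using euler_prod_log_deriv[of 2 N] by auto
  obtain D2' where D2': "has_log_deriv (euler_prod 2 (2*N)) D2'"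
    "\<And>i. i \<le> 2*N \<Longrightarrow> fps_nth D2' i = - fps_nth (sigma_fps 2) i"
    using euler_prod_log_deriv[of 2 "2*N"] by auto
  obtain D4 where D4: "has_log_deriv (euler_prod 4 N) D4"
    "\<And>i. i \<le> N \<Longrightarrow> fps_nth D4 i = - fps_nth (sigma_fps 4) i"
    using euler_prod_log_deriv[of 4 N] by auto
  define D where "D = (of_nat 4 * D2 + D2') - (of_nat 2 * D1 + of_nat 2 * D4)"
  have "has_log_deriv P D"
    unfolding D_def
  proof (rule has_log_deriv_cancel)
    show "has_log_deriv (P * (euler_prod 1 (2*N) ^ 2 * euler_prod 4 N ^ 2)) (of_nat 4 * D2 + D2')"
      unfolding eq by (intro has_log_deriv_mult has_log_deriv_power D2 D2')
    show "has_log_deriv (euler_prod 1 (2*N) ^ 2 * euler_prod 4 N ^ 2) (of_nat 2 * D1 + of_nat 2 * D4)"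
      by (intro has_log_deriv_mult has_log_deriv_power D1 D4)
    show "euler_prod 1 (2*N) ^ 2 * euler_prod 4 N ^ 2 \<noteq> 0"
      by (simp add: euler_prod_nonzero)
  qed
  moreover have "fps_nth D i = fps_nth (2 * sigma_fps 1 - 5 * sigma_fps 2 + 2 * sigma_fps 4) i"
    if "i \<le> N" for i
    using that by (simp add: D_def D1 D2 D2' D4 fps_numeral_fps_const)
  moreover have "fps_nth P i = fps_nth (count_fps (\<lambda>x::int. nat (x\<^sup>2))) i" if "i \<le> N" for i
  proof -
    let ?M = "2*N"
    let ?t = "\<lambda>s. (-1) ^ s * x ^ (s*(?M+1)) * ((\<Prod>k\<in>{s<..?M}. g k) * e s)"
    have 1: "1 + 2 * (\<Sum>s=1..m. (-1) ^ s * x ^ (s\<^sup>2)) = (\<Sum>z\<in>{-int m..int m}. ?X ^ nat (z\<^sup>2))" for m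
    proof (induction m)
      case (Suc m)
      have "{-int (Suc m)..int (Suc m)} = insert (-int (Suc m)) (insert (int (Suc m)) {-int m..int m})"
        by auto
      then have "sum h {-int (Suc m)..int (Suc m)} = sum h {-int m..int m} + h (int (Suc m)) + h (-int (Suc m))"
        for h :: "int \<Rightarrow> real fps"
        by (simp add: add_ac)
      moreover have "nat ((int (Suc m))\<^sup>2) = (Suc m)\<^sup>2"
        by (metis nat_int of_nat_power)
      moreover have "(\<Sum>s=1..Suc m. (-1) ^ s * x ^ (s\<^sup>2)) =
          (\<Sum>s=1..m. (-1) ^ s * x ^ (s\<^sup>2)) + (-1) ^ Suc m * x ^ ((Suc m)\<^sup>2)"
        by (rule sum.cl_ivl_Suc[THEN trans]) simp
      moreover have "(-1) ^ Suc m * x ^ ((Suc m)\<^sup>2) = ?X ^ ((Suc m)\<^sup>2)"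
      proof -
        have "even (Suc m + (Suc m)\<^sup>2)" by simp
        then have "(-1) ^ Suc m * (-1) ^ ((Suc m)\<^sup>2) = (1 :: real fps)"
          by (simp only: power_add[symmetric] neg_one_even_power)
        then show ?thesis unfolding x by (simp only: mult.assoc[symmetric] mult_1_left)
      qed
      ultimately show ?case by (simp only: Suc.IH[symmetric] distrib_left mult_2 power2_minus add_ac)
    qed simp
    have 2: "(\<Sum>s\<le>?M. ?t s) = 1 + 2 * (\<Sum>s=1..?M. (-1) ^ s * x ^ (s\<^sup>2))"
      by (rule shanks_square[OF g e nz])
    have "fps_nth (\<Sum>z\<in>{-int ?M..int ?M}. ?X ^ nat (z\<^sup>2)) i = (\<Sum>s\<le>?M. fps_nth (?t s) i)"
      unfolding 1[symmetric] 2[symmetric] by (rule fps_sum_nth)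
    also have "\<dots> = (\<Sum>s\<in>{0}. fps_nth (?t s) i)"
    proof (rule sum.mono_neutral_right)
      show "\<forall>s\<in>{..?M} - {0}. fps_nth (?t s) i = 0"
      proof
        fix s assume "s \<in> {..?M} - {0}"
        then have "1 * (?M+1) \<le> s*(?M+1)" by (intro mult_le_mono1) auto
        moreover have "i < 1 * (?M+1)" using that by simp
        ultimately have "i < s*(?M+1)" by (rule less_le_trans[rotated])
        then have "fps_nth (?X ^ (s*(?M+1)) * ((-1) ^ s * (-1) ^ (s*(?M+1)) *
          ((\<Prod>k\<in>{s<..?M}. g k) * e s))) i = 0"
          by (rule fps_nth_X_power_mult_small)
        then show "fps_nth (?t s) i = 0" unfolding x by (simp only: mult_ac)
      qed
    qed auto
    also have "\<dots> = fps_nth P i"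
    proof -
      have "2 * (e 0 - 1) = 0" using e[of 0] by (simp add: algebra_simps)
      then have "e 0 = 1" by simp
      then show ?thesis by (simp add: P_def atLeastSucAtMost_greaterThanAtMost)
    qed
    finally have "fps_nth P i = real (card {z\<in>{-int ?M..int ?M}. nat (z\<^sup>2) = i})"
      by (simp only: fps_nth_sum_X_power finite_atLeastAtMost_int)
    moreover have "z \<in> {-int ?M..int ?M}" if "nat (z\<^sup>2) = i" for z
    proof -
      have "\<bar>z\<bar> \<le> z\<^sup>2" by (rule abs_le_square_int)
      also have "z\<^sup>2 = int i" using that by auto
      finally show ?thesis using \<open>i \<le> N\<close> by auto
    qed
    then have "{z\<in>{-int ?M..int ?M}. nat (z\<^sup>2) = i} = {z. nat (z\<^sup>2) = i}" by blast
    ultimately show ?thesis by (simp only: count_fps_def fps_nth_Abs_fps)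
  qed
  ultimately show "\<exists>f' D'. has_log_deriv f' D' \<and>
      (\<forall>i\<le>N. fps_nth f' i = fps_nth (count_fps (\<lambda>x::int. nat (x\<^sup>2))) i) \<and>
      (\<forall>i\<le>N. fps_nth D' i = fps_nth (2 * sigma_fps 1 - 5 * sigma_fps 2 + 2 * sigma_fps 4) i)"
    by blast
qed

section \<open>The generating function of the representation numbers\<close>

text \<open>Sorting the pairs by the value of \<open>v\<close> gives a disjoint union of rectangles,
  hence a Cauchy product of counts. Finiteness is carried along because \<open>card\<close> is
  additive and multiplicative here only for finite sets.\<close>

lemma finite_card_pairs:
  fixes v :: "'a \<Rightarrow> nat" and w :: "'b \<Rightarrow> nat"
  assumes v: "\<And>i. finite {a. P a \<and> v a = i}" and w: "\<And>i. finite {b. Q b \<and> w b = i}"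
  shows "finite {(a, b). P a \<and> Q b \<and> v a + w b = n}"
    and "card {(a, b). P a \<and> Q b \<and> v a + w b = n} =
      (\<Sum>i=0..n. card {a. P a \<and> v a = i} * card {b. Q b \<and> w b = n - i})"
proof -
  have eq: "{(a, b). P a \<and> Q b \<and> v a + w b = n} =
      (\<Union>i\<in>{0..n}. {a. P a \<and> v a = i} \<times> {b. Q b \<and> w b = n - i})"
    by auto
  show "finite {(a, b). P a \<and> Q b \<and> v a + w b = n}"
    unfolding eq using v w by blast
  show "card {(a, b). P a \<and> Q b \<and> v a + w b = n} =
      (\<Sum>i=0..n. card {a. P a \<and> v a = i} * card {b. Q b \<and> w b = n - i})"
    unfolding eq using v w
    by (subst card_UN_disjoint) (auto simp: card_cartesian_product)
qed

lemma finite_card_weighted_lists: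
  fixes w :: "'a \<Rightarrow> nat"
  assumes w: "\<And>i. finite {x. w x = i}"
  shows "finite {xs. length xs = k \<and> sum_list (map w xs) = n} \<and>
    real (card {xs. length xs = k \<and> sum_list (map w xs) = n}) = fps_nth (count_fps w ^ k) n"
proof (induction k arbitrary: n)
  case 0
  have "{xs :: 'a list. length xs = 0 \<and> sum_list (map w xs) = n} = (if n = 0 then {[]} else {})"
    by auto
  then show ?case by simp
next
  case (Suc k)
  \<comment> \<open>The conjunct \<open>True\<close> is the trivial predicate on the head that fits
    the shape of \<open>finite_card_pairs\<close>.\<close>
  let ?S = "{(x, xs). True \<and> length xs = k \<and> w x + sum_list (map w xs) = n}"
  have eq: "{xs. length xs = Suc k \<and> sum_list (map w xs) = n} = (\<lambda>(x, xs). x # xs) ` ?S"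
    by (auto simp: length_Suc_conv image_iff)
  have fin: "finite ?S"
    by (rule finite_card_pairs(1)) (use w Suc in auto)
  have "card ?S = (\<Sum>i=0..n. card {x. True \<and> w x = i} *
      card {xs. length xs = k \<and> sum_list (map w xs) = n - i})"
    by (rule finite_card_pairs(2)) (use w Suc in auto)
  then have "real (card ?S) = fps_nth (count_fps w ^ Suc k) n"
    using Suc by (simp add: fps_mult_nth count_fps_def)
  moreover have "card ((\<lambda>(x, xs). x # xs) ` ?S) = card ?S"
    by (rule card_image) (auto simp: inj_on_def)
  ultimately show ?case unfolding eq using fin by simp
qed

lemma u_fps:
  "real (u k l n) =
    fps_nth (count_fps (\<lambda>x::int. nat (x\<^sup>2)) ^ k * count_fps (\<lambda>y::nat. y*(y+1) div 2) ^ l) n"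
proof -
  let ?v = "\<lambda>x::int. nat (x\<^sup>2)" and ?w = "\<lambda>y::nat. y*(y+1) div 2"
  have v: "finite {x. ?v x = i}" for i
  proof (rule finite_subset)
    show "{x. ?v x = i} \<subseteq> {-int i..int i}"
    proof
      fix z assume "z \<in> {x. ?v x = i}"
      have "\<bar>z\<bar> \<le> z\<^sup>2" by (rule abs_le_square_int)
      also have "z\<^sup>2 = int i" using \<open>z \<in> _\<close> by auto
      finally show "z \<in> {-int i..int i}" by auto
    qed
  qed simp
  have w: "finite {y. ?w y = i}" for i
  proof (rule finite_subset)
    show "{y. ?w y = i} \<subseteq> {..i}" using le_triangular by blast
  qed simp
  \<comment> \<open>Both integer sums are images of natural numbers, so the equation in
    \<open>u_def\<close> can be moved to the naturals, where the weights live.\<close>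
  have "(\<Sum>x\<leftarrow>xs. x\<^sup>2) = int (sum_list (map ?v xs))" for xs :: "int list"
    by (induction xs) auto
  moreover have "(\<Sum>y\<leftarrow>ys. int (?w y)) = int (sum_list (map ?w ys))" for ys
    by (induction ys) (auto simp del: of_nat_div)
  ultimately have "u k l n = card {(xs, ys). length xs = k \<and> length ys = l \<and>
      sum_list (map ?v xs) + sum_list (map ?w ys) = n}"
    unfolding u_def by (simp only: of_nat_add[symmetric] of_nat_eq_iff) (simp only: eq_commute)
  also have "\<dots> = (\<Sum>i=0..n. card {xs. length xs = k \<and> sum_list (map ?v xs) = i} *
      card {ys. length ys = l \<and> sum_list (map ?w ys) = n - i})"
    by (rule finite_card_pairs(2))
      (use finite_card_weighted_lists[of ?v] finite_card_weighted_lists[of ?w] v w in blast)+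
  finally show ?thesis
    using finite_card_weighted_lists[of ?v] finite_card_weighted_lists[of ?w] v w
    by (simp add: fps_mult_nth)
qed

text \<open>This value turns the summand \<open>j = 0\<close> of the final convolution into the
  terms of the recurrence outside its sum.\<close>

lemma u_0: "u k l 0 = 1"
proof -
  have "{x::int. nat (x\<^sup>2) = 0} = {0}" by auto
  then have "fps_nth (count_fps (\<lambda>x::int. nat (x\<^sup>2))) 0 = 1"
    by (simp only: count_fps_def fps_nth_Abs_fps) simp
  moreover have "y*(y+1) div 2 = 0 \<longleftrightarrow> y = 0" for y :: nat
    using le_triangular[of y] by (metis le_zero_eq mult_0 div_0)
  then have "fps_nth (count_fps (\<lambda>y::nat. y*(y+1) div 2)) 0 = 1"
    by (simp only: count_fps_def fps_nth_Abs_fps) simp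
  ultimately have "real (u k l 0) = 1"
    by (simp only: u_fps fps_mult_nth_0 fps_power_zeroth) simp
  then show ?thesis by simp
qed

theorem theorem2p6:
  fixes k l n :: nat
  assumes "k \<ge> 1" and "l \<ge> 1" and "n \<ge> 1"
  shows "int n * int (u k l n) =
      (2 * int k + int l) * int (sigma (of_nat n))
    - 2 * (5 * int k + 2 * int l) * int (sigma (of_nat n / 2))
    + 8 * int k * int (sigma (of_nat n / 4))
    + (\<Sum>j = 1..n - 1. int (u k l j) *
        ((2 * int k + int l) * int (sigma (of_nat (n - j)))
       - 2 * (5 * int k + 2 * int l) * int (sigma (of_nat (n - j) / 2))
       + 8 * int k * int (sigma (of_nat (n - j) / 4))))"
proof -
  define U where "U = count_fps (\<lambda>x::int. nat (x\<^sup>2)) ^ k * count_fps (\<lambda>y::nat. y*(y+1) div 2) ^ l"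
  define D where "D = of_nat k * (2 * sigma_fps 1 - 5 * sigma_fps 2 + 2 * sigma_fps 4)
    + of_nat l * (sigma_fps 1 - 2 * sigma_fps 2)"
  define c where "c m = (2 * int k + int l) * int (sigma (of_nat m))
       - 2 * (5 * int k + 2 * int l) * int (sigma (of_nat m / 2))
       + 8 * int k * int (sigma (of_nat m / 4))" for m
  have "has_log_deriv U D"
    unfolding U_def D_def
    by (intro has_log_deriv_mult has_log_deriv_power square_log_deriv triangular_log_deriv)
  then have eq: "fps_nth (fps_X * fps_deriv U) n = fps_nth (U * D) n"
    by (simp add: has_log_deriv_def mult.commute)
  have U: "fps_nth U i = real (u k l i)" for i
    by (simp add: U_def u_fps)
  \<comment> \<open>The factor \<open>a\<close> in \<open>sigma_fps a\<close> turns the coefficients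
    \<open>5*k + 2*l\<close> at \<open>a = 2\<close> and \<open>2*k\<close> at \<open>a = 4\<close>
    into \<open>2*(5*k + 2*l)\<close> and \<open>8*k\<close>.\<close>
  have D: "fps_nth D i = (if i = 0 then 0 else real_of_int (c i))" for i
    by (simp add: D_def c_def sigma_fps_def fps_numeral_fps_const fps_of_nat[symmetric] algebra_simps)
  have "fps_nth (fps_X * fps_deriv U) n = real n * real (u k l n)"
    using U assms by (cases n) auto
  moreover have "fps_nth (U * D) n = (\<Sum>j=0..n. real (u k l j) * (if n - j = 0 then 0 else real_of_int (c (n - j))))"
    by (simp add: fps_mult_nth U D)
  moreover have "\<dots> = real_of_int (c n + (\<Sum>j=1..n-1. int (u k l j) * c (n - j)))"
  proof -
    \<comment> \<open>The end \<open>j = n\<close> drops out because \<open>D\<close> has constant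
      term 0, and \<open>j = 0\<close> gives \<open>c n\<close>.\<close>
    have "{0..n} = insert 0 (insert n {1..n-1})" using assms by auto
    moreover have "(\<Sum>j=1..n-1. real (u k l j) * (if n - j = 0 then 0 else real_of_int (c (n - j)))) =
      (\<Sum>j=1..n-1. real (u k l j) * real_of_int (c (n - j)))"
      by (rule sum.cong) auto
    ultimately show ?thesis using assms by (simp add: u_0)
  qed
  ultimately have "real_of_int (int n * int (u k l n)) =
      real_of_int (c n + (\<Sum>j=1..n-1. int (u k l j) * c (n - j)))"
    using eq by simp
  then show ?thesis unfolding of_int_eq_iff c_def .
qed

end
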